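(* Let $\mathcal{M}=(S,\mathrm{Act},P)$ be an MDP, let $G\in S$ be an absorbing target state, let $\mathrm{opt}\in\{\inf,\sup\}$, and let $s_0\in S\setminus \mathrm{Avoid}^{\mathrm{opt}}_{\mathcal{M}}(G)$ be an initial state. Assume that $\mathcal{M}$ is finitely action-branching and $\mathrm{opt}$-decisive w.r.t. $G$ from $s_0$. Then the first approximation scheme converges on $\mathcal{M}$ from $s_0$: for every $\epsilon>0$ there exists $n\in\mathbb{N}$ such that $|p_n^{\mathrm{opt},+}-p_n^{\mathrm{opt},-}|\le\epsilon$, where $$p_n^{\mathrm{opt},-}=\mathbb{P}^{\mathrm{opt}}_{\mathcal{M}^{\mathrm{opt}},s_0}(\mathbf{F}^{\le n}G),\qquad p_n^{\mathrm{opt},+}=\mathbb{P}^{\mathrm{opt}}_{\mathcal{M}^{\mathrm{opt}},s_0}\big(\mathbf{F}^{\le n}G\vee\mathbf{G}^{\le n}(\neg G\wedge\neg\bot^{\mathrm{opt}})\big).$$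
   Context: An MDP is a tuple $\mathcal{M}=(S,\mathrm{Act},P)$ with $S$, $\mathrm{Act}$ countable and $P:S\times\mathrm{Act}\times S\to[0,1]\cap\mathbb{Q}$ with $\sum_{s'}P(s,a,s')\in\{0,1\}$ for all $(s,a)$. Action $a$ is enabled at $s$ if this sum is $1$; every state has at least one enabled action. $\mathcal{M}$ is finitely action-branching if every state has finitely many enabled actions. A state $s$ is absorbing if $P(s,a,s)=1$ for all enabled $a$. Schedulers map finite histories (sequences of states) to probability distributions over the actions enabled in the last state; $\mathrm{Sched}(\mathcal{M})$ is the set of all schedulers. Pure and positional schedulers are functions $\sigma:S\to\mathrm{Act}$ choosing an enabled action. $\mathbb{P}^\sigma_{\mathcal{M},s}$ is the induced probability measure on infinite paths from $s$, and $\mathbb{P}^{\mathrm{opt}}_{\mathcal{M},s}(E)=\mathrm{opt}_{\sigma\in\mathrm{Sched}(\mathcal{M})}\mathbb{P}^\sigma_{\mathcal{M},s}(E)$ for $\mathrm{opt}\in\{\inf,\sup\}$. For a state or set of states (or Boolean combination) $\psi$ and a path $s_0s_1\cdots$: $\mathbf{F}\psi$ means some $s_k$ satisfies $\psi$; $\mathbf{F}^{\le n}\psi$ means some $s_k$ with $k\le n$ does; $\mathbf{G}\psi$, $\mathbf{G}^{\le n}\psi$ mean all $s_k$ (resp. all with $k\le n$) do. Avoid sets: $\mathrm{Avoid}^{\mathrm{opt}}_{\mathcal{M}}(G)=\{s\in S\mid \mathbb{P}^{\mathrm{opt}}_{\mathcal{M},s}(\mathbf{F}G)=0\}$. $\mathcal{M}$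 is $\mathrm{opt}$-decisive w.r.t. $G$ from $s$ if for all pure and positional schedulers $\sigma$, $\mathbb{P}^\sigma_{\mathcal{M},s}(\mathbf{F}G\vee\mathbf{F}\,\mathrm{Avoid}^{\mathrm{opt}}_{\mathcal{M}}(G))=1$. Collapsed MDP: $\mathcal{M}^{\mathrm{opt}}=(S^{\mathrm{opt}},\mathrm{Act},P^{\mathrm{opt}})$, where $S^{\mathrm{opt}}=(S\setminus\mathrm{Avoid}^{\mathrm{opt}}_{\mathcal{M}}(G))\cup\{\bot^{\mathrm{opt}}\}$ with $\bot^{\mathrm{opt}}$ fresh; for $s,s'\ne\bot^{\mathrm{opt}}$, $P^{\mathrm{opt}}(s,a,s')=P(s,a,s')$ and $P^{\mathrm{opt}}(s,a,\bot^{\mathrm{opt}})=\sum_{s'\in\mathrm{Avoid}^{\mathrm{opt}}_{\mathcal{M}}(G)}P(s,a,s')$; and $P^{\mathrm{opt}}(\bot^{\mathrm{opt}},a,\bot^{\mathrm{opt}})=1$ for every $a\in\mathrm{Act}$. *)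

theory Defs
  imports "HOL-Probability.Probability"
begin

section \<open>Markov decision processes\<close>

record ('s, 'a) mdp =
  states :: "'s set"
  actions :: "'a set"
  trans_prob :: "'s \<Rightarrow> 'a \<Rightarrow> 's \<Rightarrow> real"

definition enabled :: "('s, 'a) mdp \<Rightarrow> 's \<Rightarrow> 'a set" where
  "enabled M s = {a \<in> actions M. (trans_prob M s a has_sum 1) (states M)}"

text \<open>
  The path measures below do not depend on the rationality of the transition probabilities.
  It is kept separate because collapsing may create an irrational (infinite) sum of rationals.
\<close>

definition real_mdp :: "('s, 'a) mdp \<Rightarrow> bool" where
  "real_mdp M \<longleftrightarrow>
     countable (states M) \<and> countable (actions M) \<and>
     (\<forall>s\<in>states M. \<forall>a\<in>actions M. \<forall>s'\<in>states M. trans_prob M s a s' \<in> {0..1}) \<and>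
     (\<forall>s\<in>states M. \<forall>a\<in>actions M.
        (trans_prob M s a has_sum 0) (states M) \<or> (trans_prob M s a has_sum 1) (states M)) \<and>
     (\<forall>s\<in>states M. enabled M s \<noteq> {})"

definition is_mdp :: "('s, 'a) mdp \<Rightarrow> bool" where
  "is_mdp M \<longleftrightarrow> real_mdp M \<and>
     (\<forall>s\<in>states M. \<forall>a\<in>actions M. \<forall>s'\<in>states M. trans_prob M s a s' \<in> \<rat>)"

definition finitely_action_branching :: "('s, 'a) mdp \<Rightarrow> bool" where
  "finitely_action_branching M \<longleftrightarrow> (\<forall>s\<in>states M. finite (enabled M s))"

definition absorbing :: "('s, 'a) mdp \<Rightarrow> 's \<Rightarrow> bool" where
  "absorbing M s \<longleftrightarrow> (\<forall>a\<in>enabled M s. trans_prob M s a s = 1)"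


section \<open>Schedulers and path measures\<close>

definition schedulers :: "('s, 'a) mdp \<Rightarrow> ('s list \<Rightarrow> 'a pmf) set" where
  "schedulers M =
     {\<sigma>. \<forall>h. h \<noteq> [] \<and> set h \<subseteq> states M \<longrightarrow> set_pmf (\<sigma> h) \<subseteq> enabled M (last h)}"

definition pure_positional :: "('s, 'a) mdp \<Rightarrow> ('s \<Rightarrow> 'a) set" where
  "pure_positional M = {\<sigma>. \<forall>s\<in>states M. \<sigma> s \<in> enabled M s}"

definition positional_scheduler :: "('s \<Rightarrow> 'a) \<Rightarrow> 's list \<Rightarrow> 'a pmf" where
  "positional_scheduler \<sigma> h = return_pmf (\<sigma> (last h))"

text \<open>Distribution of the state with index \<open>i\<close>, given the states \<open>\<omega> 0, \<dots>, \<omega> (i - 1)\<close>.\<close>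

definition step_kernel ::
    "('s, 'a) mdp \<Rightarrow> ('s list \<Rightarrow> 'a pmf) \<Rightarrow> 's \<Rightarrow> nat \<Rightarrow> (nat \<Rightarrow> 's) \<Rightarrow> 's measure" where
  "step_kernel M \<sigma> s i \<omega> =
     (if i = 0 then return (count_space (states M)) s
      else density (count_space (states M))
        (\<lambda>s'. \<integral>\<^sup>+ a. ennreal (trans_prob M (\<omega> (i - 1)) a s')
                \<partial>measure_pmf (\<sigma> (map \<omega> [0..<i]))))"

definition path_measure ::
    "('s, 'a) mdp \<Rightarrow> ('s list \<Rightarrow> 'a pmf) \<Rightarrow> 's \<Rightarrow> (nat \<Rightarrow> 's) measure" where
  "path_measure M \<sigma> s =
     projective_family.lim UNIV
       (Ionescu_Tulcea.CI (step_kernel M \<sigma> s) (\<lambda>_. count_space (states M)))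
       (\<lambda>_. count_space (states M))"

text \<open>The optimum \<open>opt\<close> is \<open>Inf\<close> or \<open>Sup\<close> on sets of reals.\<close>

definition opt_prob ::
    "(real set \<Rightarrow> real) \<Rightarrow> ('s, 'a) mdp \<Rightarrow> 's \<Rightarrow> ((nat \<Rightarrow> 's) \<Rightarrow> bool) \<Rightarrow> real" where
  "opt_prob opt M s E = opt ((\<lambda>\<sigma>. \<P>(\<omega> in path_measure M \<sigma> s. E \<omega>)) ` schedulers M)"


section \<open>Path properties\<close>

definition Fin :: "'s set \<Rightarrow> (nat \<Rightarrow> 's) \<Rightarrow> bool" where
  "Fin T \<omega> \<longleftrightarrow> (\<exists>k. \<omega> k \<in> T)"

definition Fin_le :: "nat \<Rightarrow> 's set \<Rightarrow> (nat \<Rightarrow> 's) \<Rightarrow> bool" where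
  "Fin_le n T \<omega> \<longleftrightarrow> (\<exists>k\<le>n. \<omega> k \<in> T)"

definition Glob_le :: "nat \<Rightarrow> 's set \<Rightarrow> (nat \<Rightarrow> 's) \<Rightarrow> bool" where
  "Glob_le n T \<omega> \<longleftrightarrow> (\<forall>k\<le>n. \<omega> k \<in> T)"


section \<open>Avoid sets, decisiveness and the collapsed MDP\<close>

definition Avoid :: "(real set \<Rightarrow> real) \<Rightarrow> ('s, 'a) mdp \<Rightarrow> 's set \<Rightarrow> 's set" where
  "Avoid opt M T = {s \<in> states M. opt_prob opt M s (Fin T) = 0}"

definition decisive :: "(real set \<Rightarrow> real) \<Rightarrow> ('s, 'a) mdp \<Rightarrow> 's set \<Rightarrow> 's \<Rightarrow> bool" where
  "decisive opt M T s \<longleftrightarrow>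
     (\<forall>\<sigma>\<in>pure_positional M.
        \<P>(\<omega> in path_measure M (positional_scheduler \<sigma>) s. Fin T \<omega> \<or> Fin (Avoid opt M T) \<omega>) = 1)"

text \<open>The fresh state is \<open>None\<close>.\<close>

definition collapse ::
    "(real set \<Rightarrow> real) \<Rightarrow> ('s, 'a) mdp \<Rightarrow> 's set \<Rightarrow> ('s option, 'a) mdp" where
  "collapse opt M T =
     \<lparr> states = insert None (Some ` (states M - Avoid opt M T)),
       actions = actions M,
       trans_prob = (\<lambda>x a y.
         case x of
           None \<Rightarrow> (case y of None \<Rightarrow> 1 | Some _ \<Rightarrow> 0)
         | Some s \<Rightarrow>
             (case y of
                None \<Rightarrow> (\<Sum>\<^sub>\<infinity>s'\<in>Avoid opt M T. trans_prob M s a s')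
              | Some s' \<Rightarrow> trans_prob M s a s')) \<rparr>"


section \<open>The first approximation scheme\<close>

definition lower_approx ::
    "(real set \<Rightarrow> real) \<Rightarrow> ('s, 'a) mdp \<Rightarrow> 's \<Rightarrow> 's \<Rightarrow> nat \<Rightarrow> real" where
  "lower_approx opt M G s n =
     opt_prob opt (collapse opt M {G}) (Some s) (Fin_le n {Some G})"

definition upper_approx ::
    "(real set \<Rightarrow> real) \<Rightarrow> ('s, 'a) mdp \<Rightarrow> 's \<Rightarrow> 's \<Rightarrow> nat \<Rightarrow> real" where
  "upper_approx opt M G s n =
     opt_prob opt (collapse opt M {G}) (Some s)
       (\<lambda>\<omega>. Fin_le n {Some G} \<omega> \<or> Glob_le n (- {Some G} \<inter> - {None}) \<omega>)"


section \<open>Well-definedness of the path measures\<close>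

text \<open>
  The construction of the path measures is total. The following facts show that, for an MDP and for
  its collapse, it does yield the probability measure with the expected cylinder probabilities.
\<close>

lemma prob_space_step_kernel:
  assumes M: "real_mdp M" and s: "s \<in> states M" and \<sigma>: "\<sigma> \<in> schedulers M"
    and \<omega>: "\<And>j. j < i \<Longrightarrow> \<omega> j \<in> states M"
  shows "prob_space (step_kernel M \<sigma> s i \<omega>)"
proof (cases "i = 0")
  case True
  then show ?thesis
    using s by (simp add: step_kernel_def prob_space_return)
next
  case False
  let ?S = "states M" and ?t = "\<omega> (i - 1)" and ?\<mu> = "\<sigma> (map \<omega> [0..<i])"
  have last: "last (map \<omega> [0..<i]) = ?t"
    using False by (simp add: last_map)
  have t: "?t \<in> ?S"
    using False by (intro \<omega>) simp
  have h: "set (map \<omega> [0..<i]) \<subseteq> ?S" "map \<omega> [0..<i] \<noteq> []"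
    using \<omega> False by auto
  have supp: "set_pmf ?\<mu> \<subseteq> enabled M ?t"
    using \<sigma> h unfolding schedulers_def last[symmetric] by blast
  have S: "countable ?S"
    using M by (simp add: real_mdp_def)
  have one: "(\<integral>\<^sup>+ s'. ennreal (trans_prob M ?t a s') \<partial>count_space ?S) = 1" if "a \<in> set_pmf ?\<mu>" for a
  proof -
    have a: "a \<in> actions M" and sum: "(trans_prob M ?t a has_sum 1) ?S"
      using supp that by (auto simp: enabled_def)
    have nn: "\<And>s'. s' \<in> ?S \<Longrightarrow> 0 \<le> trans_prob M ?t a s'"
      using M t a by (auto simp: real_mdp_def)
    have abs: "Infinite_Set_Sum.abs_summable_on (trans_prob M ?t a) ?S"
      using has_sum_imp_summable[OF sum] summable_on_iff_abs_summable_on_real abs_summable_equivalent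
      by blast
    have "(\<integral>\<^sup>+ s'. ennreal (trans_prob M ?t a s') \<partial>count_space ?S)
        = ennreal (infsetsum (trans_prob M ?t a) ?S)"
      using abs nn by (intro nn_integral_conv_infsetsum) auto
    also have "infsetsum (trans_prob M ?t a) ?S = 1"
      using abs sum by (metis infsetsum_infsum infsumI)
    finally show ?thesis by simp
  qed
  have "emeasure (density (count_space ?S)
      (\<lambda>s'. \<integral>\<^sup>+ a. ennreal (trans_prob M ?t a s') \<partial>measure_pmf ?\<mu>)) ?S
      = (\<integral>\<^sup>+ s'. \<integral>\<^sup>+ a. ennreal (trans_prob M ?t a s') \<partial>measure_pmf ?\<mu> \<partial>count_space ?S)"
    by (subst emeasure_density) (auto intro!: nn_integral_cong)
  also have "\<dots> = (\<integral>\<^sup>+ a. \<integral>\<^sup>+ s'. ennreal (trans_prob M ?t a s') \<partial>count_space ?S \<partial>measure_pmf ?\<mu>)"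
    using S by (rule nn_integral_count_space_nn_integral[symmetric]) auto
  also have "\<dots> = (\<integral>\<^sup>+ a. 1 \<partial>measure_pmf ?\<mu>)"
    using one by (intro nn_integral_cong_AE) (auto simp: AE_measure_pmf_iff)
  also have "\<dots> = 1"
    by simp
  finally show ?thesis
    using False by (intro prob_spaceI) (simp add: step_kernel_def)
qed

lemma Ionescu_Tulcea_step_kernel:
  assumes M: "real_mdp M" and s: "s \<in> states M" and \<sigma>: "\<sigma> \<in> schedulers M"
  shows "Ionescu_Tulcea (step_kernel M \<sigma> s) (\<lambda>_. count_space (states M))"
proof (rule Ionescu_Tulcea.intro)
  let ?C = "count_space (states M)"
  have S: "countable (states M)"
    using M by (simp add: real_mdp_def)
  have eq: "PiM {0..<i} (\<lambda>_. ?C) = count_space ({0..<i} \<rightarrow>\<^sub>E states M)" for i :: nat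
    using S by (intro count_space_PiM_finite) auto
  show *: "prob_space (step_kernel M \<sigma> s i \<omega>)" if "\<omega> \<in> space (PiM {0..<i} (\<lambda>_. ?C))" for i \<omega>
    using that by (intro prob_space_step_kernel assms) (auto simp: space_PiM PiE_iff)
  show "step_kernel M \<sigma> s i \<in> measurable (PiM {0..<i} (\<lambda>_. ?C)) (subprob_algebra ?C)" for i
    using *[of _ i] unfolding eq
    by (auto simp: space_subprob_algebra prob_space_imp_subprob_space step_kernel_def)
qed

lemma
  assumes M: "real_mdp (M :: ('s, 'a) mdp)" and s: "s \<in> states M" and \<sigma>: "\<sigma> \<in> schedulers M"
  shows prob_space_path_measure: "prob_space (path_measure M \<sigma> s)"
    and sets_path_measure: "sets (path_measure M \<sigma> s) = sets (PiM UNIV (\<lambda>_. count_space (states M)))"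
    and path_measure_cylinder_0: "w 0 \<in> states M \<Longrightarrow>
       \<P>(\<omega> in path_measure M \<sigma> s. \<omega> 0 = w 0) = (if w 0 = s then 1 else 0)"
    and path_measure_cylinder_Suc: "(\<And>i. w i \<in> states M) \<Longrightarrow>
       \<P>(\<omega> in path_measure M \<sigma> s. \<forall>i\<le>Suc n. \<omega> i = w i) =
       \<P>(\<omega> in path_measure M \<sigma> s. \<forall>i\<le>n. \<omega> i = w i) *
       measure_pmf.expectation (\<sigma> (map w [0..<Suc n])) (\<lambda>a. trans_prob M (w n) a (w (Suc n)))"
proof -
  let ?C = "count_space (states M)"
  interpret IT: Ionescu_Tulcea "step_kernel M \<sigma> s" "\<lambda>_. ?C"
    using assms by (rule Ionescu_Tulcea_step_kernel)
  have S: "countable (states M)"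
    using M by (simp add: real_mdp_def)
  have eq: "PiM {0..<i} (\<lambda>_. ?C) = count_space ({0..<i} \<rightarrow>\<^sub>E states M)" for i :: nat
    using S by (intro count_space_PiM_finite) auto
  have lim: "path_measure M \<sigma> s = IT.PF.lim"
    by (simp add: path_measure_def)
  have C: "prob_space (IT.C 0 n (\<lambda>_. undefined))" "sets (IT.C 0 n (\<lambda>_. undefined)) = Pow ({0..<n} \<rightarrow>\<^sub>E states M)" for n
    using IT.prob_space_C[of "\<lambda>_. undefined" 0 n] IT.sets_C[of "\<lambda>_. undefined" 0 n] by (auto simp: eq)
  show sets: "sets (path_measure M \<sigma> s) = sets (PiM UNIV (\<lambda>_. ?C))"
    by (simp add: lim)
  have emb: "{\<omega> \<in> space (path_measure M \<sigma> s). \<forall>i<n. \<omega> i = w i} = IT.PF.emb UNIV {0..<n} {restrict w {0..<n}}" for w n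
    by (auto simp: sets_eq_imp_space_eq[OF sets] prod_emb_def space_PiM restrict_def fun_eq_iff; metis)
  have cyl: "emeasure (path_measure M \<sigma> s) {\<omega> \<in> space (path_measure M \<sigma> s). \<forall>i<n. \<omega> i = w i} =
     emeasure (IT.C 0 n (\<lambda>_. undefined)) {restrict w {0..<n}}" if "\<And>i. i < n \<Longrightarrow> w i \<in> states M" for w n
  proof -
    have X: "{restrict w {0..<n}} \<in> sets (PiM {0..<n} (\<lambda>_. ?C))"
      using that by (auto simp: eq)
    then have [simp]: "IT.PF.emb {0..<n} {0..<n} {restrict w {0..<n}} = {restrict w {0..<n}}"
      using sets.sets_into_space[OF X] by (intro prod_emb_id) (auto simp: space_PiM)
    show ?thesis
      unfolding emb unfolding lim using X
      by (subst IT.lim) (auto simp: IT.emeasure_CI[where n=n])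
  qed
  have step: "emeasure (IT.C 0 (Suc n) (\<lambda>_. undefined)) {restrict w {0..<Suc n}} =
     emeasure (IT.C 0 n (\<lambda>_. undefined)) {restrict w {0..<n}} *
     emeasure (step_kernel M \<sigma> s n (restrict w {0..<n})) {w n}" if w: "\<And>i. i < Suc n \<Longrightarrow> w i \<in> states M" for w n
  proof -
    let ?D = "IT.C 0 n (\<lambda>_. undefined)" and ?w = "restrict w {0..<n}"
    have spD: "space ?D = {0..<n} \<rightarrow>\<^sub>E states M"
      using IT.space_C[of "\<lambda>_. undefined" 0 n] by (simp add: eq)
    have w': "restrict w {0..<Suc n} = ?w(n := w n)"
      by (auto simp: restrict_def)
    have meas: "IT.eP n \<in> measurable ?D (subprob_algebra (PiM {0..<Suc n} (\<lambda>_. ?C)))"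
      using IT.measurable_eP[of n] by (subst measurable_cong_sets[OF IT.sets_C refl]) auto
    have "emeasure (IT.C 0 (Suc n) (\<lambda>_. undefined)) {restrict w {0..<Suc n}} =
      (\<integral>\<^sup>+ x. emeasure (IT.eP n x) {restrict w {0..<Suc n}} \<partial>?D)"
      using meas w prob_space.not_empty[OF C(1)]
      by (simp, subst emeasure_bind[where N="PiM {0..<Suc n} (\<lambda>_. ?C)"]) (auto simp: eq)
    also have "\<dots> = (\<integral>\<^sup>+ x. emeasure (step_kernel M \<sigma> s n ?w) {w n} * indicator {?w} x \<partial>?D)"
    proof (intro nn_integral_cong)
      fix x assume "x \<in> space ?D"
      then have x: "x \<in> {0..<n} \<rightarrow>\<^sub>E states M" by (simp add: spD)
      then have x': "x \<in> space (PiM {0..<n} (\<lambda>_. ?C))" by (simp add: eq)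
      have "emeasure (IT.eP n x) {restrict w {0..<Suc n}} =
        emeasure (step_kernel M \<sigma> s n x) ((\<lambda>y. x(n := y)) -` {restrict w {0..<Suc n}} \<inter> states M)"
        using w by (subst IT.emeasure_eP[OF x']) (auto simp: eq)
      also have "(\<lambda>y. x(n := y)) -` {restrict w {0..<Suc n}} \<inter> states M = (if x = ?w then {w n} else {})"
      proof -
        have "x(n := y) = ?w(n := w n) \<longleftrightarrow> x = ?w \<and> y = w n" for y
        proof -
          have "x n = undefined" using x by (auto simp: PiE_def extensional_def)
          moreover have "?w n = undefined" by simp
          ultimately show ?thesis by (metis fun_upd_triv fun_upd_upd fun_upd_same)
        qed
        then have "(\<lambda>y. x(n := y)) -` {?w(n := w n)} = (if x = ?w then {w n} else {})"
          by (simp add: vimage_def)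
        then show ?thesis
          using w[of n] unfolding w' by (simp split: if_splits)
      qed
      finally have *: "emeasure (IT.eP n x) {restrict w {0..<Suc n}} =
        emeasure (step_kernel M \<sigma> s n x) (if x = ?w then {w n} else {})" .
      show "emeasure (IT.eP n x) {restrict w {0..<Suc n}} =
         emeasure (step_kernel M \<sigma> s n ?w) {w n} * indicator {?w} x"
        unfolding * by (cases "x = ?w") simp_all
    qed
    also have "\<dots> = emeasure (step_kernel M \<sigma> s n ?w) {w n} * emeasure ?D {?w}"
      using w by (subst nn_integral_cmult_indicator) (auto simp: C(2))
    finally show ?thesis by (simp add: mult.commute)
  qed
  have r0: "restrict w {0..<0} = (\<lambda>_. undefined)" for w :: "nat \<Rightarrow> 's"
    by auto
  have C0: "emeasure (IT.C 0 0 (\<lambda>_. undefined)) {restrict w {0..<0}} = 1" for w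
    unfolding r0 by (simp add: PiM_empty)
  show "prob_space (path_measure M \<sigma> s)"
    using cyl[of 0 "\<lambda>_. s"] C0[of "\<lambda>_. s"] by (intro prob_spaceI) simp
  show "\<P>(\<omega> in path_measure M \<sigma> s. \<omega> 0 = w 0) = (if w 0 = s then 1 else 0)" if "w 0 \<in> states M"
    using cyl[of 1 w] step[of 0 w] C0[of w] that s
    by (simp add: measure_def step_kernel_def)
  show "\<P>(\<omega> in path_measure M \<sigma> s. \<forall>i\<le>Suc n. \<omega> i = w i) =
       \<P>(\<omega> in path_measure M \<sigma> s. \<forall>i\<le>n. \<omega> i = w i) *
       measure_pmf.expectation (\<sigma> (map w [0..<Suc n])) (\<lambda>a. trans_prob M (w n) a (w (Suc n)))"
    if w: "\<And>i. w i \<in> states M"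
  proof -
    let ?\<mu> = "\<sigma> (map w [0..<Suc n])"
    have m: "map (restrict w {0..<Suc n}) [0..<Suc n] = map w [0..<Suc n]" by (rule map_cong) auto
    have h: "set (map w [0..<Suc n]) \<subseteq> states M" "map w [0..<Suc n] \<noteq> []" "last (map w [0..<Suc n]) = w n"
      using w by auto
    have supp: "set_pmf ?\<mu> \<subseteq> enabled M (w n)"
    proof -
      have "h \<noteq> [] \<and> set h \<subseteq> states M \<Longrightarrow> set_pmf (\<sigma> h) \<subseteq> enabled M (last h)" for h
        using \<sigma> by (simp add: schedulers_def)
      from this[of "map w [0..<Suc n]"] show ?thesis
        using h by (simp del: upt_Suc)
    qed
    then have bd: "a \<in> set_pmf ?\<mu> \<Longrightarrow> trans_prob M (w n) a (w (Suc n)) \<in> {0..1}" for a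
      using M w by (force simp: real_mdp_def enabled_def subset_iff simp del: upt_Suc)
    have "emeasure (step_kernel M \<sigma> s (Suc n) (restrict w {0..<Suc n})) {w (Suc n)}
      = (\<integral>\<^sup>+ a. ennreal (trans_prob M (w n) a (w (Suc n))) \<partial>measure_pmf ?\<mu>)"
      using w[of "Suc n"] unfolding step_kernel_def m
      by (subst if_not_P, simp, subst emeasure_density) (simp_all add: nn_integral_indicator_singleton del: upt_Suc)
    then have e: "measure (step_kernel M \<sigma> s (Suc n) (restrict w {0..<Suc n})) {w (Suc n)}
       = measure_pmf.expectation ?\<mu> (\<lambda>a. trans_prob M (w n) a (w (Suc n)))"
      using bd unfolding measure_def
      by (subst integral_eq_nn_integral) (auto simp: AE_measure_pmf_iff)
    show ?thesis
      using cyl[of "Suc (Suc n)" w] cyl[of "Suc n" w] step[of "Suc n" w] w e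
      by (simp add: measure_def enn2real_mult less_Suc_eq_le del: IT.C.simps upt_Suc)
  qed
qed

lemma real_mdp_collapse:
  assumes M: "real_mdp M" and ne0: "states M \<noteq> {}"
  shows "real_mdp (collapse opt M T)"
    and "s \<in> states M - Avoid opt M T \<Longrightarrow> enabled (collapse opt M T) (Some s) = enabled M s"
    and "enabled (collapse opt M T) None = actions M"
proof -
  let ?N = "collapse opt M T" and ?A = "Avoid opt M T"
  have sub: "?A \<subseteq> states M" by (auto simp: Avoid_def)
  have None: "(trans_prob ?N None a has_sum 1) (states ?N)" for a
  proof -
    have "(trans_prob ?N None a has_sum 1) {None} \<longleftrightarrow> ?thesis"
      by (rule has_sum_cong_neutral) (auto simp: collapse_def)
    moreover have "(trans_prob ?N None a has_sum 1) {None}"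
      by (rule has_sum_finiteI) (auto simp: collapse_def)
    ultimately show ?thesis by blast
  qed
  have Some: "(trans_prob ?N (Some s) a has_sum c) (states ?N)"
    if c: "(trans_prob M s a has_sum c) (states M)" for s a c
  proof -
    let ?f = "trans_prob M s a"
    have sA: "?f summable_on ?A"
      using summable_on_subset_banach[OF has_sum_imp_summable[OF c] sub] .
    have "(?f has_sum (c - infsum ?f ?A)) (states M - ?A)"
      using c has_sum_infsum[OF sA] sub by (rule has_sum_Diff)
    then have "((trans_prob ?N (Some s) a \<circ> Some) has_sum (c - infsum ?f ?A)) (states M - ?A)"
      by (simp add: collapse_def o_def)
    then have 1: "(trans_prob ?N (Some s) a has_sum (c - infsum ?f ?A)) (Some ` (states M - ?A))"
      by (subst has_sum_reindex) auto
    have "(trans_prob ?N (Some s) a has_sum (infsum ?f ?A + (c - infsum ?f ?A))) (insert None (Some ` (states M - ?A)))"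
      using has_sum_insert[OF _ 1, of None] by (auto simp: collapse_def)
    then show ?thesis by (simp add: collapse_def)
  qed
  have uniq: "(trans_prob M s a has_sum 0) (states M) \<or> (trans_prob M s a has_sum 1) (states M)"
    if "s \<in> states M" "a \<in> actions M" for s a
    using M that by (auto simp: real_mdp_def)
  have acts: "actions ?N = actions M" by (simp add: collapse_def)
  show enS: "enabled ?N (Some s) = enabled M s" if "s \<in> states M - ?A" for s
    using uniq[of s] that Some[of s] infsumI zero_neq_one
    unfolding enabled_def acts by (smt (verit, best) Collect_cong DiffD1)
  show enN: "enabled ?N None = actions M"
    using None unfolding enabled_def acts by auto
  have le: "infsum (trans_prob M s a) ?A \<in> {0..1}" if s: "s \<in> states M" "a \<in> actions M" for s a
  proof -
    obtain c where c: "(trans_prob M s a has_sum c) (states M)" "c \<le> 1"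
      using uniq[OF s] by auto
    have nn: "x \<in> states M \<Longrightarrow> 0 \<le> trans_prob M s a x" for x
      using M s by (auto simp: real_mdp_def)
    have "infsum (trans_prob M s a) ?A \<le> infsum (trans_prob M s a) (states M)"
      using nn sub summable_on_subset_banach[OF has_sum_imp_summable[OF c(1)] sub] has_sum_imp_summable[OF c(1)]
      by (intro infsum_mono_neutral) auto
    then show ?thesis
      using c nn sub by (auto simp: infsumI intro!: infsum_nonneg)
  qed
  have ne: "enabled ?N x \<noteq> {}" if x: "x \<in> states ?N" for x
  proof (cases x)
    case (Some s)
    then have "s \<in> states M - ?A" using x by (auto simp: collapse_def)
    then show ?thesis using enS[of s] M Some by (auto simp: real_mdp_def)
  next
    case N: None
    show ?thesis
      using M ne0 enN N by (auto simp: real_mdp_def enabled_def)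
  qed
  have "trans_prob ?N x a y \<in> {0..1}"
    if "x \<in> states ?N" "a \<in> actions ?N" "y \<in> states ?N" for x a y
    using that le M by (auto simp: collapse_def real_mdp_def)
  moreover have "(trans_prob ?N x a has_sum 0) (states ?N) \<or> (trans_prob ?N x a has_sum 1) (states ?N)"
    if "x \<in> states ?N" "a \<in> actions ?N" for x a
  proof (cases x)
    case N: None
    then show ?thesis using None by simp
  next
    case S: (Some s)
    then have "s \<in> states M" "a \<in> actions M" using that by (auto simp: collapse_def)
    from uniq[OF this] show ?thesis using Some unfolding S by blast
  qed
  moreover have "countable (states ?N)" "countable (actions ?N)"
    using M by (auto simp: collapse_def real_mdp_def)
  ultimately show "real_mdp ?N"
    using ne unfolding real_mdp_def by blast
qed

end

theory Submission
  imports Defs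
begin

text \<open>
  For every scheduler the events defining the two bounds differ by the event of staying, for \<open>n\<close>
  steps, in the set \<open>X\<close> of states that are neither \<open>G\<close> nor \<open>\<bottom>\<close>. So it is enough that the
  supremum over all schedulers of the probability of staying \<open>n\<close> steps in \<open>X\<close> tends to \<open>0\<close>. Value
  iteration \<open>v\<^sub>0 = 1\<close>, \<open>v\<^sub>n\<^sub>+\<^sub>1 s = (SUP a. \<Sum>y\<in>X. P s a y * v\<^sub>n y)\<close> bounds that supremum. The \<open>v\<^sub>n\<close>
  decrease to a limit \<open>v\<close>. As only finitely many actions are enabled at \<open>s\<close>, one of them attains the
  supremum for infinitely many \<open>n\<close>, and by monotone convergence this action \<open>\<sigma> s\<close> satisfies
  \<open>v s \<le> (\<Sum>y\<in>X. P s (\<sigma> s) y * v y)\<close>. Iterating this inequality, \<open>v s\<^sub>0\<close> is at most the probability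
  that the positional scheduler \<open>\<sigma>\<close> stays in \<open>X\<close> forever, which is \<open>0\<close> by decisiveness.
\<close>

section \<open>Cylinder events of the path measure\<close>

abbreviation cyl :: "('s, 'a) mdp \<Rightarrow> ('s list \<Rightarrow> 'a pmf) \<Rightarrow> 's \<Rightarrow> 's list \<Rightarrow> (nat \<Rightarrow> 's) set" where
  "cyl M \<sigma> s xs \<equiv> {\<omega> \<in> space (path_measure M \<sigma> s). \<forall>i<length xs. \<omega> i = xs ! i}"

lemma sets_path_coordinate:
  assumes M: "real_mdp M" and s: "s \<in> states M" and \<sigma>: "\<sigma> \<in> schedulers M"
  shows "{\<omega> \<in> space (path_measure M \<sigma> s). \<omega> i \<in> A} \<in> sets (path_measure M \<sigma> s)"
proof -
  have sets: "sets (path_measure M \<sigma> s) = sets (PiM UNIV (\<lambda>_. count_space (states M)))"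
    using M s \<sigma> by (rule sets_path_measure)
  have "(\<lambda>\<omega>. \<omega> i) \<in> measurable (path_measure M \<sigma> s) (count_space (states M))"
    unfolding measurable_cong_sets[OF sets refl] by (rule measurable_component_singleton) simp
  \<comment> \<open>\<open>A\<close> may contain points outside \<open>states M\<close>. Paths take
    values in \<open>states M\<close>, so intersecting \<open>A\<close> with it does not change the
    event.\<close>
  from measurable_sets[OF this, of "A \<inter> states M"] this show ?thesis
    by (auto simp: measurable_def vimage_def Int_def Pi_iff intro: back_subst[of "\<lambda>B. B \<in> _"])
qed

lemma path_in_states:
  assumes M: "real_mdp M" and s: "s \<in> states M" and \<sigma>: "\<sigma> \<in> schedulers M"
  shows "\<omega> \<in> space (path_measure M \<sigma> s) \<Longrightarrow> \<omega> i \<in> states M"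
  using sets_eq_imp_space_eq[OF sets_path_measure[OF M s \<sigma>]] by (auto simp: space_PiM PiE_iff)

text \<open>Indexing cylinders by lists and weighing them in \<open>ennreal\<close> lets later sums
  over countably many paths be rearranged without summability arguments. The product rule is
  \<open>path_measure_cylinder_Suc\<close>; its expectation is also a nonnegative integral because
  the integrand lies in [0,1] on the support of \<open>\<sigma> xs\<close>.\<close>

lemma emeasure_cyl_snoc:
  assumes M: "real_mdp M" and s: "s \<in> states M" and \<sigma>: "\<sigma> \<in> schedulers M"
    and xs: "xs \<noteq> []" "set xs \<subseteq> states M" and y: "y \<in> states M"
  shows "emeasure (path_measure M \<sigma> s) (cyl M \<sigma> s (xs @ [y])) =
    emeasure (path_measure M \<sigma> s) (cyl M \<sigma> s xs) *
    (\<integral>\<^sup>+ a. ennreal (trans_prob M (last xs) a y) \<partial>measure_pmf (\<sigma> xs))"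
proof -
  interpret prob_space "path_measure M \<sigma> s"
    using M s \<sigma> by (rule prob_space_path_measure)
  \<comment> \<open>The product rule speaks of infinite words in \<open>states M\<close>, so the
    list is padded with \<open>y\<close>; this also puts \<open>y\<close> at the next index.\<close>
  define w where "w i = (if i < length xs then xs ! i else y)" for i
  obtain n where n: "length xs = Suc n"
    using xs(1) by (cases xs) auto
  have w: "w i \<in> states M" for i
    using xs(2) y by (auto simp: w_def)
  have map: "map w [0..<Suc n] = xs"
    by (intro nth_equalityI) (simp_all add: n w_def del: upt_Suc)
  have last: "w n = last xs" "w (Suc n) = y"
    using n xs(1) by (simp_all add: w_def last_conv_nth)
  have "cyl M \<sigma> s xs = {\<omega> \<in> space (path_measure M \<sigma> s). \<forall>i\<le>n. \<omega> i = w i}"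
    by (auto simp: n w_def less_Suc_eq_le)
  moreover have "cyl M \<sigma> s (xs @ [y]) = {\<omega> \<in> space (path_measure M \<sigma> s). \<forall>i\<le>Suc n. \<omega> i = w i}"
    by (auto simp: n w_def less_Suc_eq_le nth_append)
  moreover have "last xs \<in> states M" "set_pmf (\<sigma> xs) \<subseteq> enabled M (last xs)"
    using xs \<sigma> by (auto simp: schedulers_def)
  then have bd: "a \<in> set_pmf (\<sigma> xs) \<Longrightarrow> trans_prob M (last xs) a y \<in> {0..1}" for a
    using M y by (auto simp: real_mdp_def enabled_def subset_iff)
  then have "ennreal (measure_pmf.expectation (\<sigma> xs) (\<lambda>a. trans_prob M (last xs) a y)) =
      (\<integral>\<^sup>+ a. ennreal (trans_prob M (last xs) a y) \<partial>measure_pmf (\<sigma> xs))"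
    by (intro nn_integral_eq_integral[symmetric] measure_pmf.integrable_const_bound[where B=1])
      (auto simp: AE_measure_pmf_iff)
  moreover have "0 \<le> measure_pmf.expectation (\<sigma> xs) (\<lambda>a. trans_prob M (last xs) a y)"
    using bd by (intro integral_nonneg_AE) (auto simp: AE_measure_pmf_iff)
  ultimately show ?thesis
    using path_measure_cylinder_Suc[OF M s \<sigma> w, of n]
    by (simp add: emeasure_eq_measure map last ennreal_mult del: upt_Suc)
qed

section \<open>Expectations over paths that stay in a set\<close>

lemma nn_integral_count_space_lists_Suc:
  assumes "countable X"
  shows "(\<integral>\<^sup>+ xs. f xs \<partial>count_space {xs. set xs \<subseteq> X \<and> length xs = Suc n}) =
    (\<integral>\<^sup>+ xs. \<integral>\<^sup>+ y. f (xs @ [y]) \<partial>count_space X \<partial>count_space {xs. set xs \<subseteq> X \<and> length xs = n})"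
proof -
  let ?L = "\<lambda>n. {xs. set xs \<subseteq> X \<and> length xs = n}"
  have L: "countable (?L n)"
    using assms by (rule countable_subset[rotated, OF countable_lists]) auto
  interpret X: sigma_finite_measure "count_space X"
    using assms by (rule sigma_finite_measure_count_space_countable)
  have prod: "count_space (?L n) \<Otimes>\<^sub>M count_space X = count_space (?L n \<times> X)"
    using L assms by (rule pair_measure_countable)
  have bij: "bij_betw (\<lambda>(xs, y). xs @ [y]) (?L n \<times> X) (?L (Suc n))"
    unfolding bij_betw_def
  proof
    show "inj_on (\<lambda>(xs, y). xs @ [y]) (?L n \<times> X)"
      by (auto simp: inj_on_def)
    have "zs \<in> (\<lambda>(xs, y). xs @ [y]) ` (?L n \<times> X)" if "zs \<in> ?L (Suc n)" for zs
      using that by (cases zs rule: rev_cases) (auto simp: image_iff)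
    then show "(\<lambda>(xs, y). xs @ [y]) ` (?L n \<times> X) = ?L (Suc n)"
      by auto
  qed
  have "(\<integral>\<^sup>+ xs. f xs \<partial>count_space (?L (Suc n))) =
      (\<integral>\<^sup>+ p. f ((\<lambda>(xs, y). xs @ [y]) p) \<partial>count_space (?L n \<times> X))"
    by (rule nn_integral_bij_count_space[OF bij, symmetric])
  also have "\<dots> = (\<integral>\<^sup>+ xs. \<integral>\<^sup>+ y. f (xs @ [y]) \<partial>count_space X \<partial>count_space (?L n))"
    unfolding prod[symmetric] by (subst X.nn_integral_fst[symmetric]) (auto simp: prod)
  finally show ?thesis .
qed

text \<open>This is the expectation of \<open>f\<close> at the state with index \<open>n\<close>,
  restricted to the paths whose states with indices 0 to \<open>n\<close> lie in \<open>X\<close>;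
  hence the length \<open>Suc n\<close>. Written as a sum over cylinders, it has a recursion that
  involves only cylinder weights.\<close>

definition path_sum ::
    "('s, 'a) mdp \<Rightarrow> ('s list \<Rightarrow> 'a pmf) \<Rightarrow> 's \<Rightarrow> 's set \<Rightarrow> nat \<Rightarrow> ('s \<Rightarrow> ennreal) \<Rightarrow> ennreal" where
  "path_sum M \<sigma> s X n f =
    (\<integral>\<^sup>+ xs. emeasure (path_measure M \<sigma> s) (cyl M \<sigma> s xs) * f (last xs)
      \<partial>count_space {xs. set xs \<subseteq> X \<and> length xs = Suc n})"

lemma path_sum_mono:
  assumes "\<And>x. x \<in> X \<Longrightarrow> f x \<le> g x"
  shows "path_sum M \<sigma> s X n f \<le> path_sum M \<sigma> s X n g"
  unfolding path_sum_def
proof (rule nn_integral_mono)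
  fix xs assume "xs \<in> space (count_space {xs. set xs \<subseteq> X \<and> length xs = Suc n})"
  then have "last xs \<in> X"
    by (cases xs rule: rev_cases) auto
  then show "emeasure (path_measure M \<sigma> s) (cyl M \<sigma> s xs) * f (last xs) \<le>
      emeasure (path_measure M \<sigma> s) (cyl M \<sigma> s xs) * g (last xs)"
    using assms by (intro mult_left_mono) auto
qed

context
  fixes M :: "('s, 'a) mdp" and \<sigma> :: "'s list \<Rightarrow> 'a pmf" and s :: 's and X :: "'s set"
  assumes M: "real_mdp M" and s: "s \<in> states M" and \<sigma>: "\<sigma> \<in> schedulers M"
    and X: "X \<subseteq> states M"
begin

lemma countable_subset_states: "countable X"
  using M X by (auto simp: real_mdp_def intro: countable_subset)

lemma path_sum_0:
  assumes "s \<in> X"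
  shows "path_sum M \<sigma> s X 0 f = f s"
proof -
  interpret prob_space "path_measure M \<sigma> s"
    using M s \<sigma> by (rule prob_space_path_measure)
  have c: "emeasure (path_measure M \<sigma> s) {\<omega> \<in> space (path_measure M \<sigma> s). \<omega> 0 = y} = indicator {s} y" if "y \<in> X" for y
    using path_measure_cylinder_0[OF M s \<sigma>, of "\<lambda>_. y"] that X
    by (auto simp: emeasure_eq_measure indicator_def)
  have "path_sum M \<sigma> s X 0 f =
      (\<integral>\<^sup>+ y. emeasure (path_measure M \<sigma> s) (cyl M \<sigma> s [y]) * f y \<partial>count_space X)"
  proof -
    have *: "{xs::'s list. set xs \<subseteq> X \<and> length xs = 0} = {[]}" by auto
    show ?thesis
      unfolding path_sum_def nn_integral_count_space_lists_Suc[OF countable_subset_states] *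
      by (simp add: nn_integral_count_space_finite)
  qed
  also have "\<dots> = (\<integral>\<^sup>+ y. f y * indicator {s} y \<partial>count_space X)"
    by (intro nn_integral_cong) (simp add: c mult.commute)
  also have "\<dots> = f s"
    using assms by (simp add: nn_integral_indicator_singleton)
  finally show ?thesis .
qed

text \<open>The last state is split off by \<open>emeasure_cyl_snoc\<close>, and Tonelli exchanges
  the sum over states with the average over actions. Splitting off the first state instead would
  change the scheduler, which may depend on the whole history.\<close>

lemma path_sum_Suc:
  "path_sum M \<sigma> s X (Suc n) f =
    (\<integral>\<^sup>+ xs. emeasure (path_measure M \<sigma> s) (cyl M \<sigma> s xs) *
       (\<integral>\<^sup>+ a. \<integral>\<^sup>+ y. ennreal (trans_prob M (last xs) a y) * f y \<partial>count_space X \<partial>measure_pmf (\<sigma> xs))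
      \<partial>count_space {xs. set xs \<subseteq> X \<and> length xs = Suc n})"
  unfolding path_sum_def nn_integral_count_space_lists_Suc[OF countable_subset_states, where n = "Suc n"]
proof (intro nn_integral_cong)
  fix xs assume "xs \<in> space (count_space {xs. set xs \<subseteq> X \<and> length xs = Suc n})"
  then have xs: "xs \<noteq> []" "set xs \<subseteq> states M"
    using X by auto
  let ?c = "emeasure (path_measure M \<sigma> s) (cyl M \<sigma> s xs)"
  have "(\<integral>\<^sup>+ y. emeasure (path_measure M \<sigma> s) (cyl M \<sigma> s (xs @ [y])) * f (last (xs @ [y])) \<partial>count_space X) =
      (\<integral>\<^sup>+ y. ?c * (\<integral>\<^sup>+ a. ennreal (trans_prob M (last xs) a y) * f y \<partial>measure_pmf (\<sigma> xs)) \<partial>count_space X)"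
    using X xs by (intro nn_integral_cong)
      (auto simp: emeasure_cyl_snoc[OF M s \<sigma>] nn_integral_multc mult.assoc simp del: length_append)
  also have "\<dots> = ?c * (\<integral>\<^sup>+ y. \<integral>\<^sup>+ a. ennreal (trans_prob M (last xs) a y) * f y \<partial>measure_pmf (\<sigma> xs) \<partial>count_space X)"
    by (simp add: nn_integral_cmult)
  also have "(\<integral>\<^sup>+ y. \<integral>\<^sup>+ a. ennreal (trans_prob M (last xs) a y) * f y \<partial>measure_pmf (\<sigma> xs) \<partial>count_space X) =
      (\<integral>\<^sup>+ a. \<integral>\<^sup>+ y. ennreal (trans_prob M (last xs) a y) * f y \<partial>count_space X \<partial>measure_pmf (\<sigma> xs))"
    by (intro nn_integral_count_space_nn_integral[symmetric] countable_subset_states) auto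
  finally show "(\<integral>\<^sup>+ y. emeasure (path_measure M \<sigma> s) (cyl M \<sigma> s (xs @ [y])) * f (last (xs @ [y])) \<partial>count_space X) =
      ?c * (\<integral>\<^sup>+ a. \<integral>\<^sup>+ y. ennreal (trans_prob M (last xs) a y) * f y \<partial>count_space X \<partial>measure_pmf (\<sigma> xs))" .
qed

text \<open>Since \<open>X\<close> is countable, the event is a countable disjoint union of
  cylinders, one for each list over \<open>X\<close> of length \<open>Suc n\<close>.\<close>

lemma emeasure_stay_eq_path_sum:
  "emeasure (path_measure M \<sigma> s) {\<omega> \<in> space (path_measure M \<sigma> s). \<forall>i\<le>n. \<omega> i \<in> X} =
    path_sum M \<sigma> s X n (\<lambda>_. 1)"
proof -
  let ?L = "{xs. set xs \<subseteq> X \<and> length xs = Suc n}"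
  have L: "countable ?L"
    using countable_subset_states by (rule countable_subset[rotated, OF countable_lists]) auto
  have meas: "cyl M \<sigma> s xs \<in> sets (path_measure M \<sigma> s)" for xs
  proof -
    have "{\<omega> \<in> space (path_measure M \<sigma> s). \<forall>i\<in>{..<length xs}. \<omega> i \<in> {xs ! i}} \<in> sets (path_measure M \<sigma> s)"
      by (rule sets.sets_Collect_finite_All[OF sets_path_coordinate[OF M s \<sigma>]]) simp
    then show ?thesis by (simp only: Ball_def lessThan_iff singleton_iff)
  qed
  have Un: "{\<omega> \<in> space (path_measure M \<sigma> s). \<forall>i\<le>n. \<omega> i \<in> X} = (\<Union>xs\<in>?L. cyl M \<sigma> s xs)"
  proof (intro set_eqI iffI)
    fix \<omega> assume \<omega>: "\<omega> \<in> {\<omega> \<in> space (path_measure M \<sigma> s). \<forall>i\<le>n. \<omega> i \<in> X}"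
    then have "map \<omega> [0..<Suc n] \<in> ?L"
      by (auto simp: less_Suc_eq_le simp del: upt_Suc)
    moreover have "\<omega> \<in> cyl M \<sigma> s (map \<omega> [0..<Suc n])"
      using \<omega> by (auto simp del: upt_Suc)
    ultimately show "\<omega> \<in> (\<Union>xs\<in>?L. cyl M \<sigma> s xs)" by blast
  qed (auto simp: less_Suc_eq_le subset_iff)
  have disj: "disjoint_family_on (cyl M \<sigma> s) ?L"
    unfolding disjoint_family_on_def
  proof (intro ballI impI)
    fix xs ys assume "xs \<in> ?L" "ys \<in> ?L" "xs \<noteq> ys"
    then obtain i where "i < Suc n" "xs ! i \<noteq> ys ! i" "length xs = Suc n" "length ys = Suc n"
      by (auto simp: list_eq_iff_nth_eq)
    then show "cyl M \<sigma> s xs \<inter> cyl M \<sigma> s ys = {}"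
      by (smt (verit) disjoint_iff mem_Collect_eq)
  qed
  show ?thesis
    unfolding Un path_sum_def using emeasure_UN_countable[OF meas L disj] by simp
qed

end

section \<open>Value iteration for staying in a set\<close>

definition stay_step :: "('s, 'a) mdp \<Rightarrow> 's set \<Rightarrow> ('s \<Rightarrow> ennreal) \<Rightarrow> 's \<Rightarrow> ennreal" where
  "stay_step M X f s =
    (SUP a\<in>enabled M s. \<integral>\<^sup>+ y. ennreal (trans_prob M s a y) * f y \<partial>count_space X)"

definition stay_value :: "('s, 'a) mdp \<Rightarrow> 's set \<Rightarrow> nat \<Rightarrow> 's \<Rightarrow> ennreal" where
  "stay_value M X n = (stay_step M X ^^ n) (\<lambda>_. 1)"

lemma stay_step_mono:
  "(\<And>y. y \<in> X \<Longrightarrow> f y \<le> g y) \<Longrightarrow> stay_step M X f s \<le> stay_step M X g s"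
  unfolding stay_step_def by (intro SUP_mono' nn_integral_mono mult_left_mono) auto

lemma nn_integral_trans_prob_le_1:
  assumes M: "real_mdp M" and X: "X \<subseteq> states M" and s: "s \<in> states M" and a: "a \<in> enabled M s"
  shows "(\<integral>\<^sup>+ y. ennreal (trans_prob M s a y) \<partial>count_space X) \<le> 1"
proof -
  have sum: "(trans_prob M s a has_sum 1) (states M)" and "a \<in> actions M"
    using a by (auto simp: enabled_def)
  then have nn: "\<And>y. y \<in> states M \<Longrightarrow> 0 \<le> trans_prob M s a y"
    using M s by (auto simp: real_mdp_def)
  have abs: "Infinite_Set_Sum.abs_summable_on (trans_prob M s a) (states M)"
    using has_sum_imp_summable[OF sum] summable_on_iff_abs_summable_on_real abs_summable_equivalent
    by blast
  have "(\<integral>\<^sup>+ y. ennreal (trans_prob M s a y) \<partial>count_space X) \<le>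
      (\<integral>\<^sup>+ y. ennreal (trans_prob M s a y) \<partial>count_space (states M))"
    using X by (auto simp: nn_integral_count_space_indicator indicator_def intro!: nn_integral_mono)
  also have "\<dots> = ennreal (infsetsum (trans_prob M s a) (states M))"
    using abs nn by (intro nn_integral_conv_infsetsum) auto
  also have "infsetsum (trans_prob M s a) (states M) = 1"
    using abs sum by (metis infsetsum_infsum infsumI)
  finally show ?thesis by simp
qed

text \<open>The first iterate is at most 1 because the transition probabilities into
  \<open>X\<close> sum to at most 1; monotonicity of \<open>stay_step\<close> propagates this to all
  later iterates.\<close>

lemma decseq_stay_value:
  assumes M: "real_mdp M" and X: "X \<subseteq> states M" and s: "s \<in> states M"
  shows "decseq (\<lambda>n. stay_value M X n s)"
proof (rule decseq_SucI)
  show "stay_value M X (Suc n) s \<le> stay_value M X n s" for n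
    using s
  proof (induction n arbitrary: s)
    case 0
    then show ?case
      using nn_integral_trans_prob_le_1[OF M X]
      by (auto simp: stay_value_def stay_step_def intro!: SUP_least)
  next
    case (Suc n)
    then have "stay_step M X (stay_value M X (Suc n)) s \<le> stay_step M X (stay_value M X n) s"
      using X by (intro stay_step_mono) auto
    then show ?case
      by (simp add: stay_value_def)
  qed
qed

text \<open>After any history, the average over the actions drawn by \<open>\<sigma>\<close> is at
  most the supremum over enabled actions, so the last step of a path can be traded for one
  application of \<open>stay_step\<close>. Index 0 is covered by \<open>s \<in> X\<close>, so
  \<open>n\<close> applications suffice.\<close>

lemma emeasure_stay_le_stay_value:
  assumes M: "real_mdp M" and X: "X \<subseteq> states M" and s: "s \<in> X" and \<sigma>: "\<sigma> \<in> schedulers M"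
  shows "emeasure (path_measure M \<sigma> s) {\<omega> \<in> space (path_measure M \<sigma> s). \<forall>i\<le>n. \<omega> i \<in> X} \<le>
    stay_value M X n s"
proof -
  have s': "s \<in> states M" using s X by auto
  have step: "path_sum M \<sigma> s X (Suc n) f \<le> path_sum M \<sigma> s X n (stay_step M X f)" for n f
    unfolding path_sum_Suc[OF M s' \<sigma> X] unfolding path_sum_def
  proof (intro nn_integral_mono mult_left_mono)
    fix xs assume "xs \<in> space (count_space {xs. set xs \<subseteq> X \<and> length xs = Suc n})"
    then have "xs \<noteq> []" "set xs \<subseteq> states M"
      using X by auto
    then have "set_pmf (\<sigma> xs) \<subseteq> enabled M (last xs)"
      using \<sigma> by (auto simp: schedulers_def)
    then have "(\<integral>\<^sup>+ a. \<integral>\<^sup>+ y. ennreal (trans_prob M (last xs) a y) * f y \<partial>count_space X \<partial>measure_pmf (\<sigma> xs)) \<le>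
        (\<integral>\<^sup>+ a. stay_step M X f (last xs) \<partial>measure_pmf (\<sigma> xs))"
      by (intro nn_integral_mono_AE) (auto simp: AE_measure_pmf_iff stay_step_def intro!: SUP_upper)
    then show "(\<integral>\<^sup>+ a. \<integral>\<^sup>+ y. ennreal (trans_prob M (last xs) a y) * f y \<partial>count_space X \<partial>measure_pmf (\<sigma> xs)) \<le>
        stay_step M X f (last xs)"
      by (simp add: measure_pmf.emeasure_space_1)
  qed simp
  \<comment> \<open>\<open>f\<close> varies in the induction because each trade replaces it by
    \<open>stay_step M X f\<close>.\<close>
  have "path_sum M \<sigma> s X n f \<le> (stay_step M X ^^ n) f s" for f
  proof (induction n arbitrary: f)
    case 0
    then show ?case
      by (simp add: path_sum_0[OF M s' \<sigma> X s])
  next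
    case (Suc n)
    from order_trans[OF step Suc] show ?case
      by (simp add: funpow_swap1)
  qed
  then show ?thesis
    by (simp add: emeasure_stay_eq_path_sum[OF M s' \<sigma> X] stay_value_def)
qed

text \<open>Along the Markov chain of \<open>\<sigma>\<close>, killed on leaving \<open>X\<close>,
  the expectation of \<open>v\<close> never decreases. It starts at \<open>v s\<close>, and since
  \<open>v\<close> is at most 1 on \<open>X\<close> it is bounded by the survival
  probability.\<close>

lemma le_emeasure_stay:
  assumes M: "real_mdp M" and X: "X \<subseteq> states M" and s: "s \<in> X" and \<sigma>: "\<sigma> \<in> pure_positional M"
    and v1: "\<And>x. x \<in> X \<Longrightarrow> v x \<le> 1"
    and v: "\<And>x. x \<in> X \<Longrightarrow> v x \<le> (\<integral>\<^sup>+ y. ennreal (trans_prob M x (\<sigma> x) y) * v y \<partial>count_space X)"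
  shows "v s \<le> emeasure (path_measure M (positional_scheduler \<sigma>) s)
    {\<omega> \<in> space (path_measure M (positional_scheduler \<sigma>) s). \<forall>i\<le>n. \<omega> i \<in> X}"
proof -
  let ?\<sigma> = "positional_scheduler \<sigma>"
  have s': "s \<in> states M" using s X by auto
  have \<sigma>': "?\<sigma> \<in> schedulers M"
    using \<sigma> by (auto simp: schedulers_def pure_positional_def positional_scheduler_def subset_iff)
  have "v s \<le> path_sum M ?\<sigma> s X n v"
  proof (induction n)
    case 0
    then show ?case by (simp add: path_sum_0[OF M s' \<sigma>' X s])
  next
    case (Suc n)
    also have "path_sum M ?\<sigma> s X n v \<le> path_sum M ?\<sigma> s X n
        (\<lambda>x. \<integral>\<^sup>+ y. ennreal (trans_prob M x (\<sigma> x) y) * v y \<partial>count_space X)"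
      by (intro path_sum_mono v)
    also have "\<dots> = path_sum M ?\<sigma> s X (Suc n) v"
      unfolding path_sum_Suc[OF M s' \<sigma>' X] unfolding path_sum_def
      by (simp add: positional_scheduler_def)
    finally show ?case .
  qed
  also have "\<dots> \<le> path_sum M ?\<sigma> s X n (\<lambda>_. 1)"
    by (intro path_sum_mono v1)
  finally show ?thesis
    by (simp add: emeasure_stay_eq_path_sum[OF M s' \<sigma>' X])
qed

section \<open>An action that is optimal in the limit\<close>

lemma INF_cmult_ennreal:
  fixes f :: "nat \<Rightarrow> ennreal"
  assumes "c < top"
  shows "(INF i. c * f i) = c * (INF i. f i)"
proof -
  \<comment> \<open>Finiteness of \<open>c\<close> gives continuity. For \<open>c = top\<close> the
    equation fails when \<open>f\<close> is positive and decreases to 0.\<close>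
  have "continuous (at_right (INF i. f i)) (\<lambda>x. c * x)"
    using ennreal_continuous_on_cmult[OF assms, of UNIV "\<lambda>x. x"]
    by (auto simp: continuous_on_eq_continuous_at intro: continuous_at_imp_continuous_at_within)
  then show ?thesis
    using continuous_at_Inf_mono[of "\<lambda>x. c * x" "range f"]
    by (simp add: mono_def image_comp mult_left_mono)
qed

lemma ex_action_INF_stay_value_le:
  assumes M: "real_mdp M" and X: "X \<subseteq> states M" and s: "s \<in> states M" and fin: "finite (enabled M s)"
  shows "\<exists>a\<in>enabled M s. (INF n. stay_value M X n s) \<le>
    (\<integral>\<^sup>+ y. ennreal (trans_prob M s a y) * (INF n. stay_value M X n y) \<partial>count_space X)"
proof -
  define g where "g n a = (\<integral>\<^sup>+ y. ennreal (trans_prob M s a y) * stay_value M X n y \<partial>count_space X)" for n a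
  have ne: "enabled M s \<noteq> {}"
    using M s by (auto simp: real_mdp_def)
  have dec: "decseq (\<lambda>n. stay_value M X n y)" if "y \<in> X" for y
    using that X by (intro decseq_stay_value M) auto
  have g: "decseq (\<lambda>n. g n a)" for a
    unfolding g_def decseq_def using dec
    by (auto simp: decseq_def intro!: nn_integral_mono mult_left_mono)
  have "\<exists>a\<in>enabled M s. stay_value M X (Suc n) s = g n a" for n
  proof -
    \<comment> \<open>Finite branching enters here: the supremum over a finite nonempty set of
      actions is attained.\<close>
    have "stay_value M X (Suc n) s = Max (g n ` enabled M s)"
      using fin ne by (simp add: stay_value_def stay_step_def g_def Max_Sup)
    also have "\<dots> \<in> g n ` enabled M s"
      using fin ne by (intro Max_in) auto
    finally show ?thesis by auto
  qed
  then obtain \<alpha> where \<alpha>: "\<And>n. \<alpha> n \<in> enabled M s" "\<And>n. stay_value M X (Suc n) s = g n (\<alpha> n)"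
    by metis
  have "finite (range \<alpha>)"
    using \<alpha>(1) by (intro finite_subset[OF _ fin]) auto
  then obtain m where m: "infinite {n. \<alpha> n = \<alpha> m}"
    using pigeonhole_infinite[of "UNIV :: nat set" \<alpha>] by auto
  \<comment> \<open>The bound holds directly only at indices \<open>k\<close> with
    \<open>\<alpha> k = \<alpha> m\<close>. These are unbounded and \<open>g\<close> decreases in
    its index, so the bound reaches every \<open>n\<close>.\<close>
  have "(INF n. stay_value M X n s) \<le> g n (\<alpha> m)" for n
  proof -
    obtain k where k: "n \<le> k" "\<alpha> k = \<alpha> m"
      using m by (auto simp: infinite_nat_iff_unbounded_le)
    have "(INF n. stay_value M X n s) \<le> g k (\<alpha> k)"
      unfolding \<alpha>(2)[symmetric] by (rule INF_lower) simp
    also have "\<dots> \<le> g n (\<alpha> m)"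
      unfolding k(2) using decseqD[OF g k(1)] .
    finally show ?thesis .
  qed
  then have "(INF n. stay_value M X n s) \<le> (INF n. g n (\<alpha> m))"
    by (rule INF_greatest)
  also have "(INF n. g n (\<alpha> m)) =
      (\<integral>\<^sup>+ y. (INF n. ennreal (trans_prob M s (\<alpha> m) y) * stay_value M X n y) \<partial>count_space X)"
    unfolding g_def
  \<comment> \<open>Monotone convergence from above needs a finite integral. At index 0 it is the
    mass that \<open>\<alpha> m\<close> moves from \<open>s\<close> into \<open>X\<close>, at most
    1.\<close>
  proof (rule nn_integral_monotone_convergence_INF_AE'[symmetric])
    show "AE y in count_space X. ennreal (trans_prob M s (\<alpha> m) y) * stay_value M X (Suc n) y \<le>
        ennreal (trans_prob M s (\<alpha> m) y) * stay_value M X n y" for n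
      using dec by (auto simp: AE_count_space decseq_Suc_iff intro!: mult_left_mono)
    show "(\<integral>\<^sup>+ y. ennreal (trans_prob M s (\<alpha> m) y) * stay_value M X 0 y \<partial>count_space X) < \<infinity>"
      using nn_integral_trans_prob_le_1[OF M X s \<alpha>(1)[of m]]
      by (auto simp: stay_value_def intro: le_less_trans)
  qed auto
  also have "\<dots> = (\<integral>\<^sup>+ y. ennreal (trans_prob M s (\<alpha> m) y) * (INF n. stay_value M X n y) \<partial>count_space X)"
    by (simp add: INF_cmult_ennreal)
  finally show ?thesis
    using \<alpha>(1) by blast
qed

section \<open>Optima over all schedulers\<close>

lemma schedulers_nonempty:
  assumes "real_mdp M"
  shows "schedulers M \<noteq> {}"
proof -
  have "(SOME a. a \<in> enabled M x) \<in> enabled M x" if "x \<in> states M" for x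
    using assms that by (auto simp: real_mdp_def some_in_eq)
  then have "(\<lambda>h. return_pmf (SOME a. a \<in> enabled M (last h))) \<in> schedulers M"
    by (auto simp: schedulers_def subset_iff)
  then show ?thesis by blast
qed

text \<open>Both optima are 1-Lipschitz for the uniform distance. So an estimate for each single
  scheduler passes to the optimum, even if the two optima are approached by different schedulers.
  The reals are only conditionally complete, hence the common bounds and the nonempty index
  set.\<close>

lemma abs_Inf_Sup_image_diff_le:
  fixes f g :: "'i \<Rightarrow> real"
  assumes opt: "opt \<in> {Inf, Sup}" and I: "I \<noteq> {}"
    and f: "\<And>i. i \<in> I \<Longrightarrow> f i \<in> {l..u}" and g: "\<And>i. i \<in> I \<Longrightarrow> g i \<in> {l..u}"
    and fg: "\<And>i. i \<in> I \<Longrightarrow> \<bar>f i - g i\<bar> \<le> e"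
  shows "\<bar>opt (f ` I) - opt (g ` I)\<bar> \<le> e"
proof -
  have bdd: "bdd_below (f ` I)" "bdd_below (g ` I)" "bdd_above (f ` I)" "bdd_above (g ` I)"
    using f g by (auto intro!: bdd_belowI[of _ l] bdd_aboveI[of _ u])
  have Inf_le: "Inf (f ` I) - e \<le> Inf (g ` I)"
    if "bdd_below (f ` I)" "\<And>i. i \<in> I \<Longrightarrow> \<bar>f i - g i\<bar> \<le> e" for f g :: "'i \<Rightarrow> real"
  proof (rule cINF_greatest[OF I])
    fix i assume "i \<in> I"
    then show "Inf (f ` I) - e \<le> g i"
      using cINF_lower[OF that(1)] that(2) by (smt (verit))
  qed
  have Sup_le: "Sup (f ` I) \<le> Sup (g ` I) + e"
    if "bdd_above (g ` I)" "\<And>i. i \<in> I \<Longrightarrow> \<bar>f i - g i\<bar> \<le> e" for f g :: "'i \<Rightarrow> real"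
  proof (rule cSUP_least[OF I])
    fix i assume "i \<in> I"
    then show "f i \<le> Sup (g ` I) + e"
      using cSUP_upper[OF _ that(1)] that(2) by (smt (verit))
  qed
  have gf: "\<And>i. i \<in> I \<Longrightarrow> \<bar>g i - f i\<bar> \<le> e"
    using fg by (simp add: abs_minus_commute)
  show ?thesis
    using opt Inf_le[OF bdd(1) fg] Inf_le[OF bdd(2) gf] Sup_le[OF bdd(4) fg] Sup_le[OF bdd(3) gf]
    by (auto simp: abs_le_iff)
qed

section \<open>Decisiveness and convergence on the collapsed MDP\<close>

text \<open>Value iteration runs in the collapsed MDP, whereas decisiveness speaks of
  \<open>M\<close>. On \<open>Y\<close> both have the same enabled actions and the same transitions
  into \<open>Y\<close>, so the actions that are optimal in the limit form a positional scheduler of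
  \<open>M\<close>, and \<open>le_emeasure_stay\<close> can be applied in \<open>M\<close>
  itself.\<close>

lemma INF_stay_value_collapse_eq_0:
  fixes M :: "('s, 'a) mdp" and G s\<^sub>0 :: 's and opt :: "real set \<Rightarrow> real"
  defines "Y \<equiv> states M - Avoid opt M {G} - {G}"
  assumes M: "real_mdp M" and fin: "finitely_action_branching M"
    and dec: "decisive opt M {G} s\<^sub>0" and s\<^sub>0: "s\<^sub>0 \<in> Y"
  shows "(INF n. stay_value (collapse opt M {G}) (Some ` Y) n (Some s\<^sub>0)) = 0"
proof -
  let ?N = "collapse opt M {G}"
  define v where "v x = (INF n. stay_value ?N (Some ` Y) n (Some x))" for x
  have Y: "Y \<subseteq> states M" "Some ` Y \<subseteq> states ?N"
    by (auto simp: Y_def collapse_def)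
  have "states M \<noteq> {}" using s\<^sub>0 Y by auto
  note N = real_mdp_collapse(1)[OF M this] and enabled_N = real_mdp_collapse(2)[OF M this]
  \<comment> \<open>The implication stands under the quantifier so that one choice gives a
    \<open>\<sigma>\<close> that is enabled on all of \<open>states M\<close>; outside
    \<open>Y\<close> any enabled action serves.\<close>
  have "\<exists>a\<in>enabled M x. x \<in> Y \<longrightarrow> v x \<le> (\<integral>\<^sup>+ y. ennreal (trans_prob M x a y) * v y \<partial>count_space Y)"
    if x: "x \<in> states M" for x
  proof (cases "x \<in> Y")
    case True
    then have en: "enabled ?N (Some x) = enabled M x"
      by (intro enabled_N) (auto simp: Y_def)
    have "Some x \<in> states ?N" "finite (enabled ?N (Some x))"
      using True Y fin x en by (auto simp: finitely_action_branching_def)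
    from ex_action_INF_stay_value_le[OF N Y(2) this]
    obtain a where a: "a \<in> enabled M x" and
      le: "v x \<le> (\<integral>\<^sup>+ y. ennreal (trans_prob ?N (Some x) a y) *
        (INF n. stay_value ?N (Some ` Y) n y) \<partial>count_space (Some ` Y))"
      unfolding en v_def by blast
    have bij: "bij_betw Some Y (Some ` Y)"
      by (simp add: bij_betw_def)
    have "v x \<le> (\<integral>\<^sup>+ y. ennreal (trans_prob M x a y) * v y \<partial>count_space Y)"
      using le unfolding nn_integral_bij_count_space[OF bij, symmetric]
      by (simp add: v_def collapse_def)
    then show ?thesis using a by blast
  next
    case False
    then show ?thesis using M x by (auto simp: real_mdp_def)
  qed
  then obtain \<sigma> where \<sigma>: "\<And>x. x \<in> states M \<Longrightarrow> \<sigma> x \<in> enabled M x"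
    "\<And>x. x \<in> Y \<Longrightarrow> v x \<le> (\<integral>\<^sup>+ y. ennreal (trans_prob M x (\<sigma> x) y) * v y \<partial>count_space Y)"
    using Y(1) by (metis subsetD)
  have pp: "\<sigma> \<in> pure_positional M"
    using \<sigma>(1) by (simp add: pure_positional_def)
  let ?\<sigma> = "positional_scheduler \<sigma>"
  have sched: "?\<sigma> \<in> schedulers M"
    using \<sigma>(1) by (auto simp: schedulers_def positional_scheduler_def subset_iff)
  have s\<^sub>0': "s\<^sub>0 \<in> states M" using s\<^sub>0 Y by auto
  let ?P = "path_measure M ?\<sigma> s\<^sub>0"
  interpret prob_space ?P
    using M s\<^sub>0' sched by (rule prob_space_path_measure)
  note meas = sets_path_coordinate[OF M s\<^sub>0' sched]
  define A where "A n = {\<omega> \<in> space ?P. \<forall>i\<in>{..n}. \<omega> i \<in> Y}" for n :: nat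
  have A: "A n \<in> sets ?P" for n
    unfolding A_def by (rule sets.sets_Collect_finite_All[OF meas]) simp
  have v1: "v x \<le> 1" for x
    unfolding v_def by (rule INF_lower2[of 0]) (simp_all add: stay_value_def)
  have "v s\<^sub>0 \<le> emeasure ?P (A n)" for n
    using le_emeasure_stay[OF M Y(1) s\<^sub>0 pp v1 \<sigma>(2), of n] by (simp add: A_def Ball_def)
  then have "v s\<^sub>0 \<le> (INF n. emeasure ?P (A n))"
    by (rule INF_greatest)
  also have "\<dots> = emeasure ?P (\<Inter>n. A n)"
    using A by (intro INF_emeasure_decseq) (auto simp: A_def decseq_def)
  \<comment> \<open>Paths remain in \<open>states M\<close>, so never leaving \<open>Y\<close> means
    missing both \<open>G\<close> and the avoid set: the complement of the event in
    \<open>decisive\<close>.\<close>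
  also have "(\<Inter>n. A n) = space ?P - {\<omega> \<in> space ?P. Fin {G} \<omega> \<or> Fin (Avoid opt M {G}) \<omega>}"
    using path_in_states[OF M s\<^sub>0' sched] by (auto simp: A_def Y_def Fin_def)
  also have "emeasure ?P \<dots> = 0"
  proof -
    have "{\<omega> \<in> space ?P. Fin {G} \<omega> \<or> Fin (Avoid opt M {G}) \<omega>} \<in> sets ?P"
      unfolding Fin_def by (intro sets.sets_Collect_disj sets.sets_Collect_countable_Ex meas)
    moreover have "prob {\<omega> \<in> space ?P. Fin {G} \<omega> \<or> Fin (Avoid opt M {G}) \<omega>} = 1"
      using dec pp by (auto simp: decisive_def)
    ultimately show ?thesis
      by (simp add: emeasure_eq_measure prob_compl)
  qed
  finally show ?thesis
    by (simp add: v_def)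
qed

theorem theorem4:
  fixes M :: "('s, 'a) mdp" and G s\<^sub>0 :: 's and opt :: "real set \<Rightarrow> real"
  assumes "is_mdp M"
    and "G \<in> states M" and "absorbing M G"
    and "opt \<in> {Inf, Sup}"
    and "s\<^sub>0 \<in> states M - Avoid opt M {G}"
    and "finitely_action_branching M"
    and "decisive opt M {G} s\<^sub>0"
  shows "\<forall>\<epsilon>>0. \<exists>n. \<bar>upper_approx opt M G s\<^sub>0 n - lower_approx opt M G s\<^sub>0 n\<bar> \<le> \<epsilon>"
proof (intro allI impI)
  fix \<epsilon> :: real assume \<epsilon>: "\<epsilon> > 0"
  let ?N = "collapse opt M {G}"
  define Y where "Y = states M - Avoid opt M {G} - {G}"
  have M: "real_mdp M" using assms(1) by (simp add: is_mdp_def)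
  have N: "real_mdp ?N"
    using assms(2) by (intro real_mdp_collapse(1) M) auto
  have Y: "Some ` Y \<subseteq> states ?N" and s\<^sub>0: "Some s\<^sub>0 \<in> states ?N"
    using assms(5) by (auto simp: Y_def collapse_def)
  \<comment> \<open>One \<open>n\<close> serves all schedulers because \<open>stay_value\<close>
    bounds them uniformly. If \<open>s\<^sub>0\<close> is not in \<open>Y\<close>, it equals
    \<open>G\<close> and any \<open>n\<close> will do.\<close>
  obtain n where n: "s\<^sub>0 \<in> Y \<Longrightarrow> stay_value ?N (Some ` Y) n (Some s\<^sub>0) \<le> ennreal \<epsilon>"
  proof (cases "s\<^sub>0 \<in> Y")
    case True
    then have "(INF n. stay_value ?N (Some ` Y) n (Some s\<^sub>0)) < ennreal \<epsilon>"
      using INF_stay_value_collapse_eq_0[OF M assms(6,7)] \<epsilon> by (simp add: Y_def)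
    then show ?thesis
      using that by (auto simp: INF_less_iff intro: less_imp_le)
  qed (use that in blast)
  define stay where "stay = (\<lambda>\<omega> :: nat \<Rightarrow> 's option. Glob_le n (- {Some G} \<inter> - {None}) \<omega>)"
  have diff: "\<bar>\<P>(\<omega> in path_measure ?N \<tau> (Some s\<^sub>0). Fin_le n {Some G} \<omega> \<or> stay \<omega>)
      - \<P>(\<omega> in path_measure ?N \<tau> (Some s\<^sub>0). Fin_le n {Some G} \<omega>)\<bar> \<le> \<epsilon>"
    if \<tau>: "\<tau> \<in> schedulers ?N" for \<tau>
  proof -
    let ?P = "path_measure ?N \<tau> (Some s\<^sub>0)"
    interpret prob_space ?P
      using N s\<^sub>0 \<tau> by (rule prob_space_path_measure)
    note meas = sets_path_coordinate[OF N s\<^sub>0 \<tau>]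
    have F: "{\<omega> \<in> space ?P. Fin_le n {Some G} \<omega>} \<in> sets ?P"
    proof -
      have "{\<omega> \<in> space ?P. \<exists>i\<in>{..n}. \<omega> i \<in> {Some G}} \<in> sets ?P"
        by (rule sets.sets_Collect_finite_Ex[OF meas]) simp
      then show ?thesis by (simp only: Fin_le_def Bex_def atMost_iff)
    qed
    have S: "{\<omega> \<in> space ?P. stay \<omega>} \<in> sets ?P"
    proof -
      have "{\<omega> \<in> space ?P. \<forall>i\<in>{..n}. \<omega> i \<in> - {Some G} \<inter> - {None}} \<in> sets ?P"
        by (rule sets.sets_Collect_finite_All[OF meas]) simp
      then show ?thesis by (simp only: stay_def Glob_le_def Ball_def atMost_iff)
    qed
    \<comment> \<open>The event \<open>stay\<close> only excludes two states; together with
      membership in \<open>states ?N\<close> this is membership in \<open>Some\<close> applied to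
      \<open>Y\<close>, the form needed for \<open>emeasure_stay_le_stay_value\<close>.\<close>
    have stay_eq: "{\<omega> \<in> space ?P. stay \<omega>} = {\<omega> \<in> space ?P. \<forall>i\<le>n. \<omega> i \<in> Some ` Y}"
    proof -
      have "\<omega> i \<in> - {Some G} \<inter> - {None} \<longleftrightarrow> \<omega> i \<in> Some ` Y" if "\<omega> \<in> space ?P" for \<omega> i
        using path_in_states[OF N s\<^sub>0 \<tau> that, of i] by (auto simp: Y_def collapse_def)
      then show ?thesis unfolding stay_def Glob_le_def by blast
    qed
    have small: "prob {\<omega> \<in> space ?P. stay \<omega>} \<le> \<epsilon>"
    proof (cases "s\<^sub>0 \<in> Y")
      case True
      then have "emeasure ?P {\<omega> \<in> space ?P. stay \<omega>} \<le> ennreal \<epsilon>"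
        unfolding stay_eq using emeasure_stay_le_stay_value[OF N Y _ \<tau>, of "Some s\<^sub>0" n] n[OF True]
        by (auto intro: order_trans)
      then show ?thesis using \<epsilon> by (simp add: emeasure_eq_measure)
    next
      case False
      then have "s\<^sub>0 = G"
        using assms(5) by (auto simp: Y_def)
      \<comment> \<open>The path starts at \<open>Some G\<close> almost surely, so
        \<open>stay\<close> already fails at index 0.\<close>
      then have "{\<omega> \<in> space ?P. stay \<omega>} \<subseteq> space ?P - {\<omega> \<in> space ?P. \<omega> 0 = Some s\<^sub>0}"
        by (auto simp: stay_def Glob_le_def)
      then have "prob {\<omega> \<in> space ?P. stay \<omega>} \<le> prob (space ?P - {\<omega> \<in> space ?P. \<omega> 0 = Some s\<^sub>0})"
        using meas[of 0 "{Some s\<^sub>0}"] by (intro finite_measure_mono) auto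
      also have "\<dots> = 0"
        using meas[of 0 "{Some s\<^sub>0}"] path_measure_cylinder_0[OF N s\<^sub>0 \<tau>, of "\<lambda>_. Some s\<^sub>0"] s\<^sub>0
        by (simp add: prob_compl)
      finally show ?thesis using \<epsilon> by simp
    qed
    \<comment> \<open>Adding the event \<open>stay\<close> to the event of the lower bound cannot
      decrease its probability and increases it by at most the probability of
      \<open>stay\<close>.\<close>
    have Un: "{\<omega> \<in> space ?P. Fin_le n {Some G} \<omega> \<or> stay \<omega>} =
        {\<omega> \<in> space ?P. Fin_le n {Some G} \<omega>} \<union> {\<omega> \<in> space ?P. stay \<omega>}"
      by auto
    show ?thesis
      using measure_Un_le[OF F S] small
        finite_measure_mono[OF Un_upper1 sets.Un[OF F S]]
      unfolding Un by linarith
  qed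
  have "\<bar>upper_approx opt M G s\<^sub>0 n - lower_approx opt M G s\<^sub>0 n\<bar> \<le> \<epsilon>"
    unfolding upper_approx_def lower_approx_def opt_prob_def
  proof (rule abs_Inf_Sup_image_diff_le[OF assms(4) schedulers_nonempty[OF N], where l = 0 and u = 1])
    fix \<tau> assume \<tau>: "\<tau> \<in> schedulers ?N"
    interpret prob_space "path_measure ?N \<tau> (Some s\<^sub>0)"
      using N s\<^sub>0 \<tau> by (rule prob_space_path_measure)
    show "prob {\<omega> \<in> space (path_measure ?N \<tau> (Some s\<^sub>0)). Q \<omega>} \<in> {0..1}" for Q by simp
    show "prob {\<omega> \<in> space (path_measure ?N \<tau> (Some s\<^sub>0)). Q \<omega>} \<in> {0..1}" for Q by simp
  qed (use diff in \<open>simp add: stay_def\<close>)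
  then show "\<exists>n. \<bar>upper_approx opt M G s\<^sub>0 n - lower_approx opt M G s\<^sub>0 n\<bar> \<le> \<epsilon>" ..
qed

end
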